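(* Suppose there are two universities $a$ and $b$ with different values $\beta_a,\beta_b$ of the preference parameter and quality thresholds $\tau_{Q,a},\tau_{Q,b}$. Assume that there are two admission metrics $A_1=t+\sigma_{Z,1}Z_1$ and $A_2=s+\sigma_{Z,2}Z_2$, and that students admitted to both universities pick one of the universities with a uniform probability $q$. Then there are two possibilities: (a) One university has a higher cutoff in both admission metrics, and a higher average type and average soft skill. (b) The university with the lower value of $\beta$ (i.e. the one that weights soft skill more heavily in its preferences) has the higher average type and the lower average soft skill.
   Context: A student has type $t$ and soft skill $s$; $t,s,Z_1,Z_2$ are mutually independent standard normal random variables, and $\sigma_{Z,1},\sigma_{Z,2}$ are fixed noise levels. For $u\in\{a,b\}$, university $u$ has preference parameter $\beta_u\in(0,1)$ and measures quality by $\beta_u t+(1-\beta_u)s$. It admits a student with $(A_1,A_2)=(a_1,a_2)$ iff $\mathbb{E}[\beta_u t+(1-\beta_u)s\mid A_1=a_1]\ge\tau_{Q,u}$ and $\mathbb{E}[\beta_u t+(1-\beta_u)s\mid A_2=a_2]\ge\tau_{Q,u}$. Equivalently, it admits iff $A_1\ge\frac{\tau_{Q,u}(1+\sigma_{Z,1}^2)}{\beta_u}$ and $A_2\ge\frac{\tau_{Q,u}(1+\sigma_{Z,2}^2)}{1-\beta_u}$; these two numbers are its cutoffs in the metrics $A_1$ and $A_2$. A student admitted to exactly one university attends it; "uniform probability $q$" means that the probability with which a student admitted to both picks a given one of the universities is the same for all such students, regardless of their attributes. The average type (soft skill) of a university is the average of $t$ (of $s$) over the students attending it.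
   Formalization: The two quality thresholds are assumed not both negative (otherwise the claim fails, e.g. β_a=1/4, β_b=3/4, both thresholds −1), and if the universities' cutoffs tie in a metric, (a) holds only with weak comparisons in that metric. *)

theory Defs
  imports "HOL-Probability.Probability"
begin

datatype university = UA | UB

text \<open>\<open>cond_exp M A Y \<omega>\<close> is \<open>E[Y | A = A \<omega>]\<close>, i.e. the conditional expectation of \<open>Y\<close> given
  the sigma-algebra generated by the Borel function \<open>A\<close>. It depends on \<open>\<omega>\<close> only through \<open>A \<omega>\<close>,
  and the choice of version is immaterial below, since averages ignore null sets.\<close>

definition cond_exp ::
    "'w measure \<Rightarrow> ('w \<Rightarrow> 'v::topological_space) \<Rightarrow> ('w \<Rightarrow> real) \<Rightarrow> 'w \<Rightarrow> real" where
  "cond_exp M A Y = real_cond_exp M (vimage_algebra (space M) A borel) Y"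

definition quality :: "real \<Rightarrow> ('w \<Rightarrow> real) \<Rightarrow> ('w \<Rightarrow> real) \<Rightarrow> 'w \<Rightarrow> real" where
  "quality \<beta> t s \<omega> = \<beta> * t \<omega> + (1 - \<beta>) * s \<omega>"

definition admits ::
    "'w measure \<Rightarrow> real \<Rightarrow> real \<Rightarrow> ('w \<Rightarrow> real) \<Rightarrow> ('w \<Rightarrow> real) \<Rightarrow> ('w \<Rightarrow> real) \<Rightarrow> ('w \<Rightarrow> real)
      \<Rightarrow> 'w \<Rightarrow> bool" where
  "admits M \<beta> \<tau> t s A\<^sub>1 A\<^sub>2 \<omega> \<longleftrightarrow>
     cond_exp M A\<^sub>1 (quality \<beta> t s) \<omega> \<ge> \<tau> \<and> cond_exp M A\<^sub>2 (quality \<beta> t s) \<omega> \<ge> \<tau>"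

text \<open>The admission rule amounts, almost surely, to \<open>A\<^sub>1\<close> and \<open>A\<^sub>2\<close> reaching the following cutoffs,
  because \<open>E[t | A\<^sub>1] = A\<^sub>1 / (1 + \<sigma>\<^sub>1\<^sup>2)\<close>, \<open>E[s | A\<^sub>1] = 0\<close>, and symmetrically for \<open>A\<^sub>2\<close>.\<close>

definition cutoff1 :: "real \<Rightarrow> real \<Rightarrow> real \<Rightarrow> real" where
  "cutoff1 \<sigma> \<beta> \<tau> = \<tau> * (1 + \<sigma>\<^sup>2) / \<beta>"

definition cutoff2 :: "real \<Rightarrow> real \<Rightarrow> real \<Rightarrow> real" where
  "cutoff2 \<sigma> \<beta> \<tau> = \<tau> * (1 + \<sigma>\<^sup>2) / (1 - \<beta>)"

text \<open>\<open>pick \<omega>\<close> is the university that student \<open>\<omega>\<close> chooses if admitted to both; it is irrelevant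
  for all other students.\<close>

definition attends ::
    "(university \<Rightarrow> 'w \<Rightarrow> bool) \<Rightarrow> ('w \<Rightarrow> university) \<Rightarrow> university \<Rightarrow> 'w \<Rightarrow> bool" where
  "attends adm pick u \<omega> \<longleftrightarrow> adm u \<omega> \<and> (\<forall>v. v \<noteq> u \<and> adm v \<omega> \<longrightarrow> pick \<omega> = u)"

definition average_over :: "'w measure \<Rightarrow> ('w \<Rightarrow> bool) \<Rightarrow> ('w \<Rightarrow> real) \<Rightarrow> real" where
  "average_over M P X =
     (LINT \<omega>:{\<omega> \<in> space M. P \<omega>}|M. X \<omega>) / measure M {\<omega> \<in> space M. P \<omega>}"

end

theory Submission
  imports Defs
begin

text \<open>
  Since the pairs \<open>(t, Z\<^sub>1)\<close> and \<open>(s, Z\<^sub>2)\<close> are independent, integrals over admission regions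
  \<open>{A\<^sub>1 \<ge> x, A\<^sub>2 \<ge> y}\<close> factorise. By uniformity of the choice, the students of \<open>u\<close> carry the weight of
  the region of \<open>u\<close> minus a constant times the weight of the intersection with the region of the other
  university \<open>v\<close>. Suppose \<open>c\<^sub>1 u \<ge> c\<^sub>1 v\<close> and let \<open>m = E[t | A\<^sub>1 \<ge> c\<^sub>1 u]\<close>. Both the region of \<open>u\<close> and the
  intersection have first cutoff \<open>c\<^sub>1 u\<close>, so both have average type \<open>m\<close>; hence \<open>u\<close> has average type
  \<open>m\<close>. Removing a multiple of the intersection from the region of \<open>v\<close>, whose average type is
  \<open>E[t | A\<^sub>1 \<ge> c\<^sub>1 v] \<le> m\<close>, leaves an average of at most \<open>m\<close>. So in each metric separately the averages
  are ordered as the cutoffs, whatever the order in the other metric; the thresholds only enter in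
  deciding which university has the smaller \<open>\<beta>\<close> when the cutoffs are ordered oppositely.
\<close>

section \<open>Gaussian densities and the regression of a trait on its noisy metric\<close>

text \<open>The left side is the joint density at \<open>(z, a)\<close> of \<open>Z\<close> and
  \<open>A = T + \<sigma> * Z\<close> for independent standard normal \<open>T\<close> and
  \<open>Z\<close>. Completing the square in \<open>z\<close> splits it into the marginal density of
  \<open>A\<close>, of variance \<open>v\<close>, and the conditional density of \<open>Z\<close>
  given \<open>A = a\<close>.\<close>

lemma std_normal_density_mult_shear:
  fixes \<sigma> a z :: real
  defines "v \<equiv> 1 + \<sigma>\<^sup>2"
  shows "std_normal_density z * std_normal_density (a - \<sigma> * z)
    = normal_density 0 (sqrt v) a * normal_density (\<sigma> * a / v) (1 / sqrt v) z"
proof -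
  have v: "v > 0" by (simp add: v_def add_pos_nonneg)
  have q: "- z\<^sup>2 / 2 - (a - \<sigma> * z)\<^sup>2 / 2 = - a\<^sup>2 / (2 * v) - v * (z - \<sigma> * a / v)\<^sup>2 / 2"
  proof -
    have "v * (z - \<sigma> * a / v)\<^sup>2 = v * z\<^sup>2 - 2 * \<sigma> * a * z + \<sigma>\<^sup>2 * a\<^sup>2 / v"
      using v by (simp add: power2_eq_square field_simps)
    moreover have "\<sigma>\<^sup>2 * a\<^sup>2 / v = a\<^sup>2 - a\<^sup>2 / v"
      using v by (simp add: field_simps) (simp add: v_def algebra_simps)
    moreover have "v * z\<^sup>2 = z\<^sup>2 + \<sigma>\<^sup>2 * z\<^sup>2" "a\<^sup>2 / (2 * v) = (a\<^sup>2 / v) / 2"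
      by (simp_all add: v_def algebra_simps)
    moreover have "(a - \<sigma> * z)\<^sup>2 = a\<^sup>2 - 2 * \<sigma> * a * z + \<sigma>\<^sup>2 * z\<^sup>2"
      by (simp add: power2_eq_square algebra_simps)
    ultimately show ?thesis
      by linarith
  qed
  have "std_normal_density z * std_normal_density (a - \<sigma> * z)
      = 1 / (2 * pi) * exp (- z\<^sup>2 / 2 - (a - \<sigma> * z)\<^sup>2 / 2)"
  proof -
    have "exp (- z\<^sup>2 / 2 - (a - \<sigma> * z)\<^sup>2 / 2) = exp (- z\<^sup>2 / 2) * exp (- (a - \<sigma> * z)\<^sup>2 / 2)"
      by (simp flip: exp_add)
    moreover have "1 / (2 * pi) = 1 / sqrt (2 * pi) * (1 / sqrt (2 * pi))"
      by simp
    ultimately show ?thesis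
      by (simp only: std_normal_density_def ac_simps)
  qed
  also have "\<dots> = normal_density 0 (sqrt v) a * normal_density (\<sigma> * a / v) (1 / sqrt v) z"
  proof -
    \<comment> \<open>The normalising constants for variances \<open>v\<close> and
      \<open>1 / v\<close> multiply to that of two standard normals.\<close>
    have "sqrt (2 * pi * v) * sqrt (2 * pi / v) = 2 * pi"
      using v by (simp flip: real_sqrt_mult add: real_sqrt_unique power2_eq_square)
    then have "1 / (2 * pi) = 1 / sqrt (2 * pi * v) * (1 / sqrt (2 * pi / v))"
      by simp
    moreover have "normal_density 0 (sqrt v) a = 1 / sqrt (2 * pi * v) * exp (- a\<^sup>2 / (2 * v))"
      "normal_density (\<sigma> * a / v) (1 / sqrt v) z
        = 1 / sqrt (2 * pi / v) * exp (- v * (z - \<sigma> * a / v)\<^sup>2 / 2)"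
      using v by (simp_all add: normal_density_def power_divide mult.commute)
    moreover have "exp (- a\<^sup>2 / (2 * v) - v * (z - \<sigma> * a / v)\<^sup>2 / 2)
        = exp (- a\<^sup>2 / (2 * v)) * exp (- v * (z - \<sigma> * a / v)\<^sup>2 / 2)"
      by (simp flip: exp_add)
    ultimately show ?thesis
      unfolding q by (simp only: ac_simps)
  qed
  finally show ?thesis .
qed

lemma integrable_of_bool_mult:
  fixes f :: "'a \<Rightarrow> real"
  assumes "integrable M f" "{\<omega> \<in> space M. P \<omega>} \<in> sets M"
  shows "integrable M (\<lambda>\<omega>. of_bool (P \<omega>) * f \<omega>)"
proof -
  have "integrable M (\<lambda>\<omega>. indicator {\<omega> \<in> space M. P \<omega>} \<omega> *\<^sub>R f \<omega>)"
    by (rule integrable_mult_indicator) (use assms in auto)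
  also have "?this \<longleftrightarrow> integrable M (\<lambda>\<omega>. of_bool (P \<omega>) * f \<omega>)"
    by (rule Bochner_Integration.integrable_cong) (auto split: split_indicator)
  finally show ?thesis .
qed

context prob_space
begin

lemma integral_of_bool_eq_prob:
  "{\<omega> \<in> space M. P \<omega>} \<in> sets M \<Longrightarrow> (\<integral>\<omega>. of_bool (P \<omega>) \<partial>M) = prob {\<omega> \<in> space M. P \<omega>}"
proof -
  assume [measurable]: "{\<omega> \<in> space M. P \<omega>} \<in> sets M"
  have "(\<integral>\<omega>. of_bool (P \<omega>) \<partial>M) = (\<integral>\<omega>. indicator {\<omega> \<in> space M. P \<omega>} \<omega> \<partial>M :: real)"
    by (rule Bochner_Integration.integral_cong) (auto split: split_indicator)
  then show ?thesis by simp
qed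

lemma integrable_std_normal:
  assumes "distributed M lborel T std_normal_density"
  shows "integrable M T"
  using distributed_integrable[OF assms, of "\<lambda>x. x"] integrable_std_normal_moment[of 1] by simp

text \<open>In the coordinates \<open>(Z, A)\<close> with \<open>A = T + \<sigma> Z\<close>, the conditional law of \<open>Z\<close> given \<open>A\<close> is normal
  with mean \<open>\<sigma> A / (1 + \<sigma>\<^sup>2)\<close>, and \<open>T - A / (1 + \<sigma>\<^sup>2)\<close> is a multiple of the centred \<open>Z\<close>.\<close>

lemma std_normal_regression:
  fixes T Z :: "'a \<Rightarrow> real" and \<sigma> :: real
  assumes T: "distributed M lborel T std_normal_density"
    and Z: "distributed M lborel Z std_normal_density"
    and indep: "indep_var borel Z borel T"
    and [measurable]: "B \<in> sets borel"
  shows "(\<integral>\<omega>. indicator B (T \<omega> + \<sigma> * Z \<omega>) * T \<omega> \<partial>M)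
    = (\<integral>\<omega>. indicator B (T \<omega> + \<sigma> * Z \<omega>) * ((T \<omega> + \<sigma> * Z \<omega>) / (1 + \<sigma>\<^sup>2)) \<partial>M)"
proof -
  define v where "v = 1 + \<sigma>\<^sup>2"
  have v: "v > 0" by (simp add: v_def add_pos_nonneg)
  have [measurable]: "T \<in> borel_measurable M" "Z \<in> borel_measurable M"
    using T Z by (auto simp: distributed_def)
  have iT: "integrable M T" and iZ: "integrable M Z"
    using T Z integrable_std_normal by auto
  then have iA: "integrable M (\<lambda>\<omega>. (T \<omega> + \<sigma> * Z \<omega>) / v)"
    by auto
  have bound: "integrable M (\<lambda>\<omega>. indicator B (T \<omega> + \<sigma> * Z \<omega>) * (f \<omega> :: real))" if "integrable M f" for f
    by (rule Bochner_Integration.integrable_bound[OF that]) (use that in \<open>auto split: split_indicator\<close>)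
  \<comment> \<open>\<open>g\<close> is the residual of the regression on the event; the claim is
    that its expectation vanishes. \<open>h\<close> weights it with the joint density, and
    \<open>k\<close> is \<open>h\<close> in the coordinates \<open>(z, a)\<close> with
    \<open>a = x + \<sigma> * z\<close>.\<close>
  define g where "g = (\<lambda>(z, x). indicator B (x + \<sigma> * z) * (x - (x + \<sigma> * z) / v))"
  have [measurable]: "g \<in> borel_measurable (lborel \<Otimes>\<^sub>M lborel)"
    unfolding g_def by measurable
  define h where "h = (\<lambda>(z, x). std_normal_density z * std_normal_density x * g (z, x))"
  have hm[measurable]: "h \<in> borel_measurable (lborel \<Otimes>\<^sub>M lborel)"
    unfolding h_def by measurable
  define k where "k = (\<lambda>(z, a). h (z, a - \<sigma> * z))"
  have km[measurable]: "k \<in> borel_measurable (lborel \<Otimes>\<^sub>M lborel)"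
    unfolding k_def by measurable
  have joint: "distributed M (lborel \<Otimes>\<^sub>M lborel) (\<lambda>\<omega>. (Z \<omega>, T \<omega>))
      (\<lambda>(z, x). ennreal (std_normal_density z) * ennreal (std_normal_density x))"
    using T Z indep_var_compose[OF indep, of id lborel id lborel]
    by (intro distributed_joint_indep) (auto intro: lborel.sigma_finite_measure_axioms)
  then have joint: "distributed M (lborel \<Otimes>\<^sub>M lborel) (\<lambda>\<omega>. (Z \<omega>, T \<omega>))
      (\<lambda>p. ennreal (std_normal_density (fst p) * std_normal_density (snd p)))"
    by (simp add: case_prod_beta' ennreal_mult)
  have ig: "integrable M (\<lambda>\<omega>. g (Z \<omega>, T \<omega>))"
    unfolding g_def by (simp add: bound Bochner_Integration.integrable_diff[OF iT iA])
  then have ih: "integrable (lborel \<Otimes>\<^sub>M lborel) h"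
    using distributed_integrable[OF joint, of g] by (simp add: h_def case_prod_beta')
  have eh: "(\<integral>\<omega>. g (Z \<omega>, T \<omega>) \<partial>M) = (\<integral>p. h p \<partial>(lborel \<Otimes>\<^sub>M lborel))"
    using distributed_integral[OF joint, of g] by (simp add: h_def case_prod_beta')
  \<comment> \<open>For fixed \<open>z\<close> the change of coordinates is a translation, so slice
    integrals and slice integrability carry over.\<close>
  have shift: "(\<integral>a. k (z, a) \<partial>lborel) = (\<integral>x. h (z, x) \<partial>lborel)"
    "(\<integral>a. norm (k (z, a)) \<partial>lborel) = (\<integral>x. norm (h (z, x)) \<partial>lborel)"
    "integrable lborel (\<lambda>a. k (z, a)) \<longleftrightarrow> integrable lborel (\<lambda>x. h (z, x))" for z
    using lborel_integral_real_affine[of 1 "\<lambda>x. h (z, x)" "- \<sigma> * z"]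
      lborel_integral_real_affine[of 1 "\<lambda>x. norm (h (z, x))" "- \<sigma> * z"]
      lborel_integrable_real_affine_iff[of 1 "\<lambda>x. h (z, x)" "- \<sigma> * z"]
    by (simp_all add: k_def)
  \<comment> \<open>Integrability of \<open>k\<close> on the plane is rebuilt from its slices; it
    licenses the exchange of the order of integration below.\<close>
  have ik: "integrable (lborel \<Otimes>\<^sub>M lborel) k"
  proof (rule lborel_pair.Fubini_integrable)
    show "integrable lborel (\<lambda>z. \<integral>a. norm (k (z, a)) \<partial>lborel)"
      unfolding shift using lborel_pair.integrable_fst'[OF integrable_norm[OF ih]] .
    show "AE z in lborel. integrable lborel (\<lambda>a. k (z, a))"
      unfolding shift using lborel_pair.AE_integrable_fst'[OF ih] .
  qed (rule km)
  \<comment> \<open>The residual is a multiple of \<open>z\<close> minus its conditional mean, so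
    for fixed \<open>a\<close> the integral over \<open>z\<close> is a first central moment. The
    exponent \<open>2 * 0 + 1\<close> matches the general formula for odd moments.\<close>
  have k: "k (z, a) = - \<sigma> * indicator B a * normal_density 0 (sqrt v) a
      * (normal_density (\<sigma> * a / v) (1 / sqrt v) z * (z - \<sigma> * a / v) ^ (2 * 0 + 1))" for z a
  proof -
    have "a - \<sigma> * z - a / v = - \<sigma> * (z - \<sigma> * a / v)"
      using v by (simp add: field_simps) (simp add: v_def algebra_simps power2_eq_square)
    then show ?thesis
      using std_normal_density_mult_shear[of z a \<sigma>, folded v_def]
      by (simp add: k_def h_def g_def)
  qed
  have inner: "(\<integral>z. k (z, a) \<partial>lborel) = 0" for a
    unfolding k using integral_normal_moment_odd[of "1 / sqrt v" "\<sigma> * a / v" 0] v by simp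
  have "(\<integral>\<omega>. g (Z \<omega>, T \<omega>) \<partial>M) = (\<integral>z. (\<integral>x. h (z, x) \<partial>lborel) \<partial>lborel)"
    unfolding eh using lborel_pair.integral_fst'[OF ih] by simp
  also have "\<dots> = (\<integral>z. (\<integral>a. k (z, a) \<partial>lborel) \<partial>lborel)"
    by (simp add: shift)
  also have "\<dots> = (\<integral>a. (\<integral>z. k (z, a) \<partial>lborel) \<partial>lborel)"
    using lborel_pair.Fubini_integral[of "\<lambda>z a. k (z, a)"] ik by simp
  also have "\<dots> = 0"
    by (simp add: inner)
  finally have "(\<integral>\<omega>. indicator B (T \<omega> + \<sigma> * Z \<omega>) * (T \<omega> - (T \<omega> + \<sigma> * Z \<omega>) / v) \<partial>M) = 0"
    by (simp add: g_def)
  then have "(\<integral>\<omega>. indicator B (T \<omega> + \<sigma> * Z \<omega>) * T \<omega>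
      - indicator B (T \<omega> + \<sigma> * Z \<omega>) * ((T \<omega> + \<sigma> * Z \<omega>) / v) \<partial>M) = 0"
    by (simp add: right_diff_distrib)
  then show ?thesis
    unfolding v_def[symmetric]
    by (subst (asm) Bochner_Integration.integral_diff) (use bound[OF iT] bound[OF iA] in simp_all)
qed

text \<open>A normal density is positive everywhere, so a null event would force the interval to be
  Lebesgue null. This supplies the strictness in the comparison of truncated means.\<close>

lemma normal_prob_interval_pos:
  fixes X :: "'a \<Rightarrow> real"
  assumes X: "distributed M lborel X (normal_density \<mu> \<sigma>)" and "\<sigma> > 0" "x < y"
  shows "prob {\<omega> \<in> space M. x \<le> X \<omega> \<and> X \<omega> < y} > 0"
proof -
  have "emeasure M (X -` {x..<y} \<inter> space M) = (\<integral>\<^sup>+a. ennreal (normal_density \<mu> \<sigma> a) * indicator {x..<y} a \<partial>lborel)"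
    using X by (rule distributed_emeasure) simp
  also have "\<dots> \<noteq> 0"
  proof
    assume "(\<integral>\<^sup>+a. ennreal (normal_density \<mu> \<sigma> a) * indicator {x..<y} a \<partial>lborel) = 0"
    then have "AE a in lborel. a \<notin> {x..<y}"
      by (subst (asm) nn_integral_0_iff_AE)
        (auto simp: indicator_def less_imp_neq[OF normal_density_pos[OF \<open>\<sigma> > 0\<close>], symmetric] elim!: eventually_mono
          split: if_splits dest: leD)
    then have "emeasure lborel {x..<y} = 0"
      by (subst (asm) AE_iff_measurable[of "{x..<y}"]) auto
    with \<open>x < y\<close> show False by simp
  qed
  also have "X -` {x..<y} \<inter> space M = {\<omega> \<in> space M. x \<le> X \<omega> \<and> X \<omega> < y}" by auto
  finally show ?thesis
    by (simp add: emeasure_eq_measure zero_less_measure_iff)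
qed

lemma distributed_noisy_std_normal:
  fixes T Z :: "'a \<Rightarrow> real"
  assumes T: "distributed M lborel T std_normal_density"
    and Z: "distributed M lborel Z std_normal_density"
    and indep: "indep_var borel Z borel T"
  shows "distributed M lborel (\<lambda>\<omega>. T \<omega> + \<sigma> * Z \<omega>) (normal_density 0 (sqrt (1 + \<sigma>\<^sup>2)))"
\<comment> \<open>For \<open>\<sigma> = 0\<close> the noise term is constant and has no density, so
  the rule for sums of independent normals does not apply.\<close>
proof (cases "\<sigma> = 0")
  case True
  then show ?thesis using T by simp
next
  case False
  have "distributed M lborel (\<lambda>\<omega>. 0 + \<sigma> * Z \<omega>) (normal_density (0 + \<sigma> * 0) (\<bar>\<sigma>\<bar> * 1))"
    by (rule normal_density_affine[OF Z]) (use False in auto)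
  then have sZ: "distributed M lborel (\<lambda>\<omega>. \<sigma> * Z \<omega>) (normal_density 0 \<bar>\<sigma>\<bar>)"
    by simp
  have "indep_var borel ((\<lambda>z. \<sigma> * z) \<circ> Z) borel (id \<circ> T)"
    by (rule indep_var_compose[OF indep]) auto
  then have i: "indep_var borel (\<lambda>\<omega>. \<sigma> * Z \<omega>) borel T"
    by (simp add: comp_def)
  show ?thesis
    using add_indep_normal[OF i _ _ sZ T] False by (simp add: add.commute)
qed

lemma indep_var_sym:
  assumes "indep_var S X T Y"
  shows "indep_var T Y S X"
  using assms unfolding indep_var_eq indep_sets2_eq
  by (metis (no_types, lifting) Int_commute mult.commute)

lemma indep_var_integral_mult:
  fixes f g :: "'b \<Rightarrow> real"
  assumes "indep_var S X T Y" and "f \<in> borel_measurable S" "g \<in> borel_measurable T"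
    and "integrable M (\<lambda>\<omega>. f (X \<omega>))" "integrable M (\<lambda>\<omega>. g (Y \<omega>))"
  shows "(\<integral>\<omega>. f (X \<omega>) * g (Y \<omega>) \<partial>M) = (\<integral>\<omega>. f (X \<omega>) \<partial>M) * (\<integral>\<omega>. g (Y \<omega>) \<partial>M)"
  using indep_var_lebesgue_integral[OF indep_var_compose[OF assms(1-3)]] assms(4,5)
  by (simp add: comp_def)

end

section \<open>Two noisy metrics: factorisation, truncated means and conditional
  expectations\<close>

lemma subalgebra_vimage_borel:
  assumes "X \<in> borel_measurable M"
  shows "subalgebra M (vimage_algebra (space M) X borel)"
  using assms by (auto simp: subalgebra_def sets_vimage_algebra2 intro: measurable_sets)

lemma borel_measurable_vimage_algebra:
  "X \<in> borel_measurable (vimage_algebra (space M) X borel)"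
  by (rule measurable_vimage_algebra1) simp

text \<open>Independence is kept as three pairwise statements, noise from trait within each metric
  and pair from pair across metrics; this form is stable under exchanging the metrics.\<close>

locale two_metrics = prob_space M for M :: "'w measure" +
  fixes t s Z\<^sub>1 Z\<^sub>2 A\<^sub>1 A\<^sub>2 :: "'w \<Rightarrow> real" and \<sigma>\<^sub>1 \<sigma>\<^sub>2 :: real
  assumes std_normal: "\<And>X. X \<in> {t, s, Z\<^sub>1, Z\<^sub>2} \<Longrightarrow> distributed M lborel X std_normal_density"
    and indep_noise1: "indep_var borel Z\<^sub>1 borel t"
    and indep_noise2: "indep_var borel Z\<^sub>2 borel s"
    and indep_traits: "indep_var (borel \<Otimes>\<^sub>M borel) (\<lambda>\<omega>. (t \<omega>, Z\<^sub>1 \<omega>)) (borel \<Otimes>\<^sub>M borel) (\<lambda>\<omega>. (s \<omega>, Z\<^sub>2 \<omega>))"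
    and A1: "A\<^sub>1 = (\<lambda>\<omega>. t \<omega> + \<sigma>\<^sub>1 * Z\<^sub>1 \<omega>)"
    and A2: "A\<^sub>2 = (\<lambda>\<omega>. s \<omega> + \<sigma>\<^sub>2 * Z\<^sub>2 \<omega>)"
begin

text \<open>Lets every statement about type and \<open>A\<^sub>1\<close> be reused for soft skill
  and \<open>A\<^sub>2\<close>.\<close>

lemma two_metrics_swap: "two_metrics M s t Z\<^sub>2 Z\<^sub>1 A\<^sub>2 A\<^sub>1 \<sigma>\<^sub>2 \<sigma>\<^sub>1"
  by unfold_locales
    (auto intro: std_normal indep_noise1 indep_noise2 indep_var_sym[OF indep_traits] simp: A1 A2)

lemma measurable_traits[measurable]:
  "t \<in> borel_measurable M" "s \<in> borel_measurable M" "Z\<^sub>1 \<in> borel_measurable M" "Z\<^sub>2 \<in> borel_measurable M"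
  using std_normal by (auto simp: distributed_def)

lemma measurable_metrics[measurable]:
  "A\<^sub>1 \<in> borel_measurable M" "A\<^sub>2 \<in> borel_measurable M"
  unfolding A1 A2 by measurable

lemma integrable_traits: "integrable M t" "integrable M s" "integrable M Z\<^sub>1" "integrable M Z\<^sub>2"
  using std_normal by (auto intro: integrable_std_normal)

lemma integrable_metrics: "integrable M A\<^sub>1" "integrable M A\<^sub>2"
  unfolding A1 A2 using integrable_traits by auto

lemma regression:
  assumes "{a. P a} \<in> sets borel"
  shows "(\<integral>\<omega>. of_bool (P (A\<^sub>1 \<omega>)) * t \<omega> \<partial>M) = (\<integral>\<omega>. of_bool (P (A\<^sub>1 \<omega>)) * (A\<^sub>1 \<omega> / (1 + \<sigma>\<^sub>1\<^sup>2)) \<partial>M)"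
  using std_normal_regression[OF std_normal std_normal indep_noise1 assms]
  by (simp add: A1 indicator_def of_bool_def)

lemma prob_metric_interval_pos:
  assumes "x < y"
  shows "prob {\<omega> \<in> space M. x \<le> A\<^sub>1 \<omega> \<and> A\<^sub>1 \<omega> < y} > 0"
  unfolding A1
  by (rule normal_prob_interval_pos[OF distributed_noisy_std_normal[OF std_normal std_normal indep_noise1]])
    (use assms in \<open>auto simp: add_pos_nonneg\<close>)

text \<open>\<open>f\<close> takes the whole pair \<open>(t, Z\<^sub>1)\<close>, so it can carry
  both the trait and an event in \<open>A\<^sub>1\<close>; the event in \<open>A\<^sub>2\<close> is
  a function of the other pair.\<close>

lemma indep_integral_mult:
  assumes f: "f \<in> borel_measurable (borel \<Otimes>\<^sub>M borel)" and P: "{y. P y} \<in> sets borel"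
    and i: "integrable M (\<lambda>\<omega>. f (t \<omega>, Z\<^sub>1 \<omega>) :: real)"
  shows "(\<integral>\<omega>. f (t \<omega>, Z\<^sub>1 \<omega>) * of_bool (P (A\<^sub>2 \<omega>)) \<partial>M)
    = (\<integral>\<omega>. f (t \<omega>, Z\<^sub>1 \<omega>) \<partial>M) * (\<integral>\<omega>. of_bool (P (A\<^sub>2 \<omega>)) \<partial>M)"
proof -
  define g :: "real \<times> real \<Rightarrow> real" where "g = (\<lambda>(x, z). indicator {y. P y} (x + \<sigma>\<^sub>2 * z))"
  note [measurable] = P
  have [measurable]: "g \<in> borel_measurable (borel \<Otimes>\<^sub>M borel)"
    unfolding g_def by measurable
  have g: "of_bool (P (A\<^sub>2 \<omega>)) = g (s \<omega>, Z\<^sub>2 \<omega>)" for \<omega>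
    by (simp add: g_def A2 indicator_def)
  show ?thesis
    unfolding g
    by (rule indep_var_integral_mult[OF indep_traits f _ i])
      (auto simp: g_def intro!: integrable_const_bound[where B=1] split: split_indicator)
qed

lemma integral_quadrant_type:
  "(\<integral>\<omega>. of_bool (x \<le> A\<^sub>1 \<omega> \<and> y \<le> A\<^sub>2 \<omega>) * t \<omega> \<partial>M)
    = (\<integral>\<omega>. of_bool (x \<le> A\<^sub>1 \<omega>) * t \<omega> \<partial>M) * prob {\<omega> \<in> space M. y \<le> A\<^sub>2 \<omega>}"
proof -
  have "(\<integral>\<omega>. of_bool (x \<le> A\<^sub>1 \<omega> \<and> y \<le> A\<^sub>2 \<omega>) * t \<omega> \<partial>M)
    = (\<integral>\<omega>. (\<lambda>(t, z). of_bool (x \<le> t + \<sigma>\<^sub>1 * z) * t) (t \<omega>, Z\<^sub>1 \<omega>) * of_bool (y \<le> A\<^sub>2 \<omega>) \<partial>M)"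
    by (simp add: A1 of_bool_conj ac_simps)
  also have "\<dots> = (\<integral>\<omega>. of_bool (x \<le> A\<^sub>1 \<omega>) * t \<omega> \<partial>M) * (\<integral>\<omega>. of_bool (y \<le> A\<^sub>2 \<omega>) \<partial>M)"
    by (subst indep_integral_mult) (auto simp: A1 intro!: integrable_of_bool_mult integrable_traits)
  finally show ?thesis
    by (simp add: integral_of_bool_eq_prob)
qed

lemma prob_quadrant:
  "prob {\<omega> \<in> space M. x \<le> A\<^sub>1 \<omega> \<and> y \<le> A\<^sub>2 \<omega>}
    = prob {\<omega> \<in> space M. x \<le> A\<^sub>1 \<omega>} * prob {\<omega> \<in> space M. y \<le> A\<^sub>2 \<omega>}"
proof -
  have "prob {\<omega> \<in> space M. x \<le> A\<^sub>1 \<omega> \<and> y \<le> A\<^sub>2 \<omega>}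
    = (\<integral>\<omega>. (\<lambda>(t, z). of_bool (x \<le> t + \<sigma>\<^sub>1 * z)) (t \<omega>, Z\<^sub>1 \<omega>) * of_bool (y \<le> A\<^sub>2 \<omega>) \<partial>M)"
    by (subst integral_of_bool_eq_prob[symmetric]) (auto simp: A1 of_bool_conj)
  also have "\<dots> = (\<integral>\<omega>. of_bool (x \<le> A\<^sub>1 \<omega>) \<partial>M) * (\<integral>\<omega>. of_bool (y \<le> A\<^sub>2 \<omega>) \<partial>M)"
    by (subst indep_integral_mult) (auto simp: A1 intro!: integrable_const_bound[where B=1])
  finally show ?thesis
    by (simp add: integral_of_bool_eq_prob)
qed

lemma prob_metric_tail_pos: "prob {\<omega> \<in> space M. x \<le> A\<^sub>1 \<omega>} > 0"
proof -
  have "0 < prob {\<omega> \<in> space M. x \<le> A\<^sub>1 \<omega> \<and> A\<^sub>1 \<omega> < x + 1}"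
    by (rule prob_metric_interval_pos) simp
  also have "\<dots> \<le> prob {\<omega> \<in> space M. x \<le> A\<^sub>1 \<omega>}"
    by (rule finite_measure_mono) auto
  finally show ?thesis .
qed

text \<open>Lowering the cutoff from \<open>y\<close> to \<open>x\<close> adds a strip on which
  \<open>E[t | A\<^sub>1] = A\<^sub>1 / v\<close> is below \<open>y / v\<close>, while on the old
  tail it is at least \<open>y / v\<close>. The strip has positive probability, so the mean drops.
  The inequality of means is cross-multiplied.\<close>

lemma truncated_type_less:
  assumes "x < y"
  shows "(\<integral>\<omega>. of_bool (x \<le> A\<^sub>1 \<omega>) * t \<omega> \<partial>M) * prob {\<omega> \<in> space M. y \<le> A\<^sub>1 \<omega>}
    < (\<integral>\<omega>. of_bool (y \<le> A\<^sub>1 \<omega>) * t \<omega> \<partial>M) * prob {\<omega> \<in> space M. x \<le> A\<^sub>1 \<omega>}"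
proof -
  define v where "v = 1 + \<sigma>\<^sub>1\<^sup>2"
  have v: "v > 0" by (simp add: v_def add_pos_nonneg)
  \<comment> \<open>\<open>G\<close> and \<open>p\<close> belong to a tail, \<open>g\<close> and
    \<open>d\<close> to the strip between the cutoffs.\<close>
  define G p where "G = (\<lambda>x. \<integral>\<omega>. of_bool (x \<le> A\<^sub>1 \<omega>) * t \<omega> \<partial>M)"
    and "p = (\<lambda>x. prob {\<omega> \<in> space M. x \<le> A\<^sub>1 \<omega>})"
  define g d where "g = (\<integral>\<omega>. of_bool (x \<le> A\<^sub>1 \<omega> \<and> A\<^sub>1 \<omega> < y) * t \<omega> \<partial>M)"
    and "d = prob {\<omega> \<in> space M. x \<le> A\<^sub>1 \<omega> \<and> A\<^sub>1 \<omega> < y}"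
  have int: "integrable M (\<lambda>\<omega>. of_bool (P (A\<^sub>1 \<omega>)) * f \<omega>)"
    if "integrable M f" "{a. P a} \<in> sets borel" for P and f :: "'w \<Rightarrow> real"
    using integrable_of_bool_mult[OF that(1)] measurable_sets[OF measurable_metrics(1) that(2)]
    by (simp add: vimage_def Int_def conj_commute)
  have "G x = (\<integral>\<omega>. of_bool (y \<le> A\<^sub>1 \<omega>) * t \<omega> + of_bool (x \<le> A\<^sub>1 \<omega> \<and> A\<^sub>1 \<omega> < y) * t \<omega> \<partial>M)"
    unfolding G_def using assms by (intro Bochner_Integration.integral_cong) auto
  then have G: "G x = G y + g"
    unfolding G_def g_def
    by (simp only:) (rule Bochner_Integration.integral_add;
      intro int[of t "\<lambda>a. y \<le> a"] int[of t "\<lambda>a. x \<le> a \<and> a < y"] integrable_traits; measurable)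
  have "p x = prob ({\<omega> \<in> space M. y \<le> A\<^sub>1 \<omega>} \<union> {\<omega> \<in> space M. x \<le> A\<^sub>1 \<omega> \<and> A\<^sub>1 \<omega> < y})"
    unfolding p_def using assms by (intro arg_cong[where f=prob]) auto
  then have p: "p x = p y + d"
    unfolding p_def d_def by (subst (asm) finite_measure_Union) auto
  have "g = (\<integral>\<omega>. of_bool (x \<le> A\<^sub>1 \<omega> \<and> A\<^sub>1 \<omega> < y) * (A\<^sub>1 \<omega> / v) \<partial>M)"
    unfolding g_def v_def by (rule regression) auto
  also have "\<dots> < (\<integral>\<omega>. of_bool (x \<le> A\<^sub>1 \<omega> \<and> A\<^sub>1 \<omega> < y) * (y / v) \<partial>M)"
  proof (rule integral_less_AE)
    show "emeasure M {\<omega> \<in> space M. x \<le> A\<^sub>1 \<omega> \<and> A\<^sub>1 \<omega> < y} \<noteq> 0"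
      using prob_metric_interval_pos[OF assms] by (simp add: emeasure_eq_measure)
  qed (use v in \<open>auto intro!: int AE_I2 simp: integrable_metrics divide_le_cancel\<close>)
  also have "\<dots> = d * (y / v)"
    unfolding d_def by (simp add: integral_of_bool_eq_prob)
  finally have g: "g < d * (y / v)" .
  have "p y * (y / v) = (\<integral>\<omega>. of_bool (y \<le> A\<^sub>1 \<omega>) * (y / v) \<partial>M)"
    unfolding p_def by (simp add: integral_of_bool_eq_prob)
  also have "\<dots> \<le> (\<integral>\<omega>. of_bool (y \<le> A\<^sub>1 \<omega>) * (A\<^sub>1 \<omega> / v) \<partial>M)"
    by (rule integral_mono) (use v in \<open>auto intro!: int simp: integrable_metrics divide_le_cancel\<close>)
  also have "\<dots> = G y"
    unfolding G_def v_def by (rule regression[symmetric]) auto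
  finally have Gy: "p y * (y / v) \<le> G y" .
  have "p y > 0" "d > 0"
    unfolding p_def d_def by (rule prob_metric_tail_pos prob_metric_interval_pos assms)+
  \<comment> \<open>\<open>y / v\<close> separates the mean \<open>g / d\<close> of the strip from
    the mean \<open>G y / p y\<close> of the tail.\<close>
  then have "g * p y < d * (y / v) * p y" "d * (p y * (y / v)) \<le> d * G y"
    using mult_strict_right_mono[OF g] mult_left_mono[OF Gy] by simp_all
  then have "g * p y < d * G y"
    by (simp add: ac_simps)
  then show ?thesis
    using G p unfolding G_def p_def by (simp add: algebra_simps)
qed

text \<open>Checks the characterising property on events of \<open>A\<^sub>1\<close>: the type part
  is the regression, and the skill part integrates to zero because \<open>s\<close> is centred and
  independent of \<open>A\<^sub>1\<close>. Free coefficients let the exchanged version serve for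
  \<open>A\<^sub>2\<close>.\<close>

lemma cond_exp_quality:
  "AE \<omega> in M. cond_exp M A\<^sub>1 (\<lambda>\<omega>. a * t \<omega> + b * s \<omega>) \<omega> = a * (A\<^sub>1 \<omega> / (1 + \<sigma>\<^sub>1\<^sup>2))"
proof -
  let ?F = "vimage_algebra (space M) A\<^sub>1 borel"
  interpret F: finite_measure_subalgebra M ?F
    by unfold_locales (rule subalgebra_vimage_borel[OF measurable_metrics(1)])
  show ?thesis
    unfolding cond_exp_def
  proof (rule F.real_cond_exp_charact)
    fix S assume "S \<in> sets ?F"
    then obtain B where B: "B \<in> sets borel" "S = A\<^sub>1 -` B \<inter> space M"
      by (auto simp: sets_vimage_algebra2)
    have ind: "(LINT \<omega>:S|M. f \<omega>) = (\<integral>\<omega>. of_bool (A\<^sub>1 \<omega> \<in> B) * f \<omega> \<partial>M)" for f :: "'w \<Rightarrow> real"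
      unfolding set_lebesgue_integral_def B(2)
      by (rule Bochner_Integration.integral_cong) (auto split: split_indicator)
    have int: "integrable M (\<lambda>\<omega>. of_bool (A\<^sub>1 \<omega> \<in> B) * f \<omega>)" if "integrable M f" for f :: "'w \<Rightarrow> real"
      by (rule integrable_of_bool_mult[OF that]) (use B(1) in measurable)
    interpret swap: two_metrics M s t Z\<^sub>2 Z\<^sub>1 A\<^sub>2 A\<^sub>1 \<sigma>\<^sub>2 \<sigma>\<^sub>1
      by (rule two_metrics_swap)
    have "(\<integral>\<omega>. of_bool (A\<^sub>1 \<omega> \<in> B) * s \<omega> \<partial>M) = (\<integral>\<omega>. fst (s \<omega>, Z\<^sub>2 \<omega>) * of_bool (A\<^sub>1 \<omega> \<in> B) \<partial>M)"
      by (simp add: mult.commute)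
    also have "\<dots> = (\<integral>\<omega>. s \<omega> \<partial>M) * (\<integral>\<omega>. of_bool (A\<^sub>1 \<omega> \<in> B) \<partial>M)"
      by (subst swap.indep_integral_mult) (use B(1) integrable_traits in auto)
    also have "(\<integral>\<omega>. s \<omega> \<partial>M) = 0"
      using standard_normal_distributed_expectation std_normal by auto
    finally have s: "(\<integral>\<omega>. of_bool (A\<^sub>1 \<omega> \<in> B) * s \<omega> \<partial>M) = 0" by simp
    have "(LINT \<omega>:S|M. a * t \<omega> + b * s \<omega>)
        = (\<integral>\<omega>. a * (of_bool (A\<^sub>1 \<omega> \<in> B) * t \<omega>) + b * (of_bool (A\<^sub>1 \<omega> \<in> B) * s \<omega>) \<partial>M)"
      unfolding ind by (simp add: algebra_simps)
    also have "\<dots> = a * (\<integral>\<omega>. of_bool (A\<^sub>1 \<omega> \<in> B) * t \<omega> \<partial>M)"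
      by (subst Bochner_Integration.integral_add) (auto intro!: int simp: integrable_traits s)
    also have "\<dots> = (LINT \<omega>:S|M. a * (A\<^sub>1 \<omega> / (1 + \<sigma>\<^sub>1\<^sup>2)))"
      unfolding ind using regression[of "\<lambda>a. a \<in> B"] B(1)
      by (simp flip: integral_mult_right_zero add: ac_simps)
    finally show "(LINT \<omega>:S|M. a * t \<omega> + b * s \<omega>) = (LINT \<omega>:S|M. a * (A\<^sub>1 \<omega> / (1 + \<sigma>\<^sub>1\<^sup>2)))" .
  qed (use integrable_traits integrable_metrics borel_measurable_vimage_algebra[of A\<^sub>1 M]
        in \<open>auto intro!: Bochner_Integration.integrable_add integrable_mult_right\<close>)
qed

end

section \<open>Comparing averages over a quadrant minus a multiple of the intersection\<close>

text \<open>\<open>p\<close> and \<open>G\<close> stand for probability and type integral of the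
  tail at the higher first cutoff, \<open>H\<close> and \<open>L\<close> for the second-metric
  probabilities of the own region and of the intersection; primes mark the other university. The
  right quotient collapses to \<open>G / p\<close>, and on comparing the left one with
  \<open>G / p\<close> the \<open>k'\<close> terms cancel.\<close>

lemma weighted_mean_le:
  fixes p p' G G' H H' L k k' :: real
  assumes "p > 0" "H' > 0" "p * H - k * (p * L) > 0" "p' * H' - k' * (p * L) > 0"
  shows "G' * p \<le> G * p' \<Longrightarrow>
      (G' * H' - k' * (G * L)) / (p' * H' - k' * (p * L)) \<le> (G * H - k * (G * L)) / (p * H - k * (p * L))"
    and "G' * p < G * p' \<Longrightarrow>
      (G' * H' - k' * (G * L)) / (p' * H' - k' * (p * L)) < (G * H - k * (G * L)) / (p * H - k * (p * L))"
proof -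
  have "(G * H - k * (G * L)) / (p * H - k * (p * L)) = G / p"
    using assms(1,3) by (simp add: field_simps)
  moreover have "(G' * H' - k' * (G * L)) * p - G * (p' * H' - k' * (p * L)) = (G' * p - G * p') * H'"
    by (simp add: algebra_simps)
  moreover have "(G' * p - G * p') * H' \<le> 0" if "G' * p \<le> G * p'"
    using that assms(2) by (simp add: mult_le_0_iff)
  moreover have "(G' * p - G * p') * H' < 0" if "G' * p < G * p'"
    using that assms(2) by (simp add: mult_less_0_iff)
  moreover have "n / d \<le> G / p \<longleftrightarrow> n * p - G * d \<le> 0" "n / d < G / p \<longleftrightarrow> n * p - G * d < 0"
    if "d > 0" for n d
    using that assms(1) by (simp_all add: pos_divide_le_eq pos_divide_less_eq pos_le_divide_eq pos_less_divide_eq)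
  ultimately show "G' * p \<le> G * p' \<Longrightarrow>
      (G' * H' - k' * (G * L)) / (p' * H' - k' * (p * L)) \<le> (G * H - k * (G * L)) / (p * H - k * (p * L))"
    and "G' * p < G * p' \<Longrightarrow>
      (G' * H' - k' * (G * L)) / (p' * H' - k' * (p * L)) < (G * H - k * (G * L)) / (p * H - k * (p * L))"
    using assms(4) by simp_all
qed

lemma neq_university_iff: "v \<noteq> u \<longleftrightarrow> v = (if u = UA then UB else UA)"
  by (cases u; cases v) auto

lemma all_university_iff: "(\<forall>u. P u) \<longleftrightarrow> P UA \<and> P UB"
  by (metis university.exhaust)

context two_metrics
begin

definition quadrant :: "real \<Rightarrow> real \<Rightarrow> 'w \<Rightarrow> bool" where
  "quadrant x y \<omega> \<longleftrightarrow> x \<le> A\<^sub>1 \<omega> \<and> y \<le> A\<^sub>2 \<omega>"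

lemma measurable_quadrant[measurable]: "Measurable.pred M (quadrant x y)"
  unfolding quadrant_def by measurable

text \<open>\<open>quadrant x z\<close> plays the intersection: its first cutoff is the larger one,
  \<open>x\<close>, while \<open>z\<close> stays arbitrary. After factorisation the second metric
  contributes only weights, and truncated means in the first metric decide.\<close>

lemma weighted_type_le:
  assumes "x' \<le> x"
    and D: "prob {\<omega> \<in> space M. quadrant x y \<omega>} - k * prob {\<omega> \<in> space M. quadrant x z \<omega>} > 0" (is "?D > 0")
    and D': "prob {\<omega> \<in> space M. quadrant x' y' \<omega>} - k' * prob {\<omega> \<in> space M. quadrant x z \<omega>} > 0" (is "?D' > 0")
  defines "N \<equiv> (\<integral>\<omega>. of_bool (quadrant x y \<omega>) * t \<omega> \<partial>M) - k * (\<integral>\<omega>. of_bool (quadrant x z \<omega>) * t \<omega> \<partial>M)"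
    and "N' \<equiv> (\<integral>\<omega>. of_bool (quadrant x' y' \<omega>) * t \<omega> \<partial>M) - k' * (\<integral>\<omega>. of_bool (quadrant x z \<omega>) * t \<omega> \<partial>M)"
  shows "N' / ?D' \<le> N / ?D" "x' < x \<Longrightarrow> N' / ?D' < N / ?D"
proof -
  interpret swap: two_metrics M s t Z\<^sub>2 Z\<^sub>1 A\<^sub>2 A\<^sub>1 \<sigma>\<^sub>2 \<sigma>\<^sub>1
    by (rule two_metrics_swap)
  note mean = weighted_mean_le[OF prob_metric_tail_pos swap.prob_metric_tail_pos
      D[unfolded quadrant_def prob_quadrant] D'[unfolded quadrant_def prob_quadrant]]
  show strict: "N' / ?D' < N / ?D" if "x' < x"
    unfolding N_def N'_def quadrant_def prob_quadrant integral_quadrant_type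
    by (rule mean(2)) (rule truncated_type_less[OF that])
  show "N' / ?D' \<le> N / ?D"
  proof (cases "x' = x")
    case True
    then show ?thesis
      unfolding N_def N'_def quadrant_def prob_quadrant integral_quadrant_type
      by (intro mean(1)) simp
  next
    case False
    with strict \<open>x' \<le> x\<close> show ?thesis by simp
  qed
qed

end

section \<open>Admission, uniform choice and the averages of the two universities\<close>

locale two_universities = two_metrics M t s Z\<^sub>1 Z\<^sub>2 A\<^sub>1 A\<^sub>2 \<sigma>\<^sub>1 \<sigma>\<^sub>2
  for M :: "'w measure" and t s Z\<^sub>1 Z\<^sub>2 A\<^sub>1 A\<^sub>2 \<sigma>\<^sub>1 \<sigma>\<^sub>2 +
  fixes q :: real and \<beta> \<tau> :: "university \<Rightarrow> real"
    and adm att :: "university \<Rightarrow> 'w \<Rightarrow> bool" and pick :: "'w \<Rightarrow> university"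
  assumes beta: "\<And>u. 0 < \<beta> u \<and> \<beta> u < 1"
    and adm: "adm = (\<lambda>u. admits M (\<beta> u) (\<tau> u) t s A\<^sub>1 A\<^sub>2)"
    and pick_measurable[measurable]: "pick \<in> measurable M (count_space UNIV)"
    and pick_uniform: "AE \<omega> in M. (\<forall>u. adm u \<omega>) \<longrightarrow>
          cond_exp M (\<lambda>\<omega>. (t \<omega>, s \<omega>, A\<^sub>1 \<omega>, A\<^sub>2 \<omega>)) (\<lambda>\<omega>. of_bool (pick \<omega> = UA)) \<omega> = q"
    and att: "att = attends adm pick"
    and att_pos: "\<And>u. measure M {\<omega> \<in> space M. att u \<omega>} > 0"
begin

definition cut1 where "cut1 u = cutoff1 \<sigma>\<^sub>1 (\<beta> u) (\<tau> u)"
definition cut2 where "cut2 u = cutoff2 \<sigma>\<^sub>2 (\<beta> u) (\<tau> u)"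

text \<open>The regression formula, used directly and with the metrics exchanged, turns both
  conditional expectations into rescaled metrics; dividing by \<open>\<beta> u\<close> and
  \<open>1 - \<beta> u\<close> preserves the inequalities as both are positive.\<close>

lemma adm_iff: "AE \<omega> in M. adm u \<omega> \<longleftrightarrow> quadrant (cut1 u) (cut2 u) \<omega>"
proof -
  interpret swap: two_metrics M s t Z\<^sub>2 Z\<^sub>1 A\<^sub>2 A\<^sub>1 \<sigma>\<^sub>2 \<sigma>\<^sub>1
    by (rule two_metrics_swap)
  have q: "quality (\<beta> u) t s = (\<lambda>\<omega>. \<beta> u * t \<omega> + (1 - \<beta> u) * s \<omega>)"
    "quality (\<beta> u) t s = (\<lambda>\<omega>. (1 - \<beta> u) * s \<omega> + \<beta> u * t \<omega>)"
    by (auto simp: quality_def)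
  have le: "\<tau> u \<le> b * (a / (1 + \<sigma>\<^sup>2)) \<longleftrightarrow> \<tau> u * (1 + \<sigma>\<^sup>2) / b \<le> a" if "b > 0" for a b \<sigma> :: real
  proof -
    have "1 + \<sigma>\<^sup>2 > 0" by (simp add: add_pos_nonneg)
    then show ?thesis using that by (simp add: pos_le_divide_eq pos_divide_le_eq mult.commute)
  qed
  show ?thesis
    using cond_exp_quality[of "\<beta> u" "1 - \<beta> u", folded q(1)]
      swap.cond_exp_quality[of "1 - \<beta> u" "\<beta> u", folded q(2)]
  proof eventually_elim
    case (elim \<omega>)
    then show ?case
      using beta[of u] le[of "\<beta> u" "A\<^sub>1 \<omega>" \<sigma>\<^sub>1] le[of "1 - \<beta> u" "A\<^sub>2 \<omega>" \<sigma>\<^sub>2]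
      by (simp add: adm admits_def quadrant_def cut1_def cut2_def cutoff1_def cutoff2_def)
  qed
qed

lemma measurable_adm[measurable]: "Measurable.pred M (adm u)"
  unfolding adm admits_def cond_exp_def by measurable

lemma measurable_att[measurable]: "Measurable.pred M (att u)"
proof -
  have "att u = (\<lambda>\<omega>. adm u \<omega> \<and> (adm (if u = UA then UB else UA) \<omega> \<longrightarrow> pick \<omega> = u))"
    by (auto simp: att attends_def neq_university_iff split: if_splits)
  then show ?thesis by simp
qed

definition share where "share u = (if u = UA then q else 1 - q)"

text \<open>Uniformity of the choice enters through the following lemma: \<open>f\<close> and membership in both admission
  regions are functions of \<open>(t, s, A\<^sub>1, A\<^sub>2)\<close>, so the choice can be replaced by its conditional
  probability.\<close>

lemma integral_pick:
  assumes f: "f \<in> borel_measurable borel" and i: "integrable M (\<lambda>\<omega>. f (t \<omega>, s \<omega>, A\<^sub>1 \<omega>, A\<^sub>2 \<omega>) :: real)"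
    and sub: "\<And>\<omega> u. quadrant x y \<omega> \<Longrightarrow> quadrant (cut1 u) (cut2 u) \<omega>"
  shows "(\<integral>\<omega>. of_bool (quadrant x y \<omega> \<and> pick \<omega> = u) * f (t \<omega>, s \<omega>, A\<^sub>1 \<omega>, A\<^sub>2 \<omega>) \<partial>M)
    = share u * (\<integral>\<omega>. of_bool (quadrant x y \<omega>) * f (t \<omega>, s \<omega>, A\<^sub>1 \<omega>, A\<^sub>2 \<omega>) \<partial>M)"
proof -
  define X where "X = (\<lambda>\<omega>. (t \<omega>, s \<omega>, A\<^sub>1 \<omega>, A\<^sub>2 \<omega>))"
  have X[measurable]: "X \<in> borel_measurable M"
    unfolding X_def by measurable
  define F where "F = vimage_algebra (space M) X borel"
  interpret F: finite_measure_subalgebra M F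
    unfolding F_def by unfold_locales (rule subalgebra_vimage_borel[OF X])
  define g where "g = (\<lambda>(a, b, c, d). of_bool (x \<le> c \<and> y \<le> d) * f (a, b, c, d))"
  have [measurable]: "f \<in> borel_measurable (borel \<Otimes>\<^sub>M borel \<Otimes>\<^sub>M borel \<Otimes>\<^sub>M borel)"
    using f by (simp add: borel_prod)
  have "g \<in> borel_measurable (borel \<Otimes>\<^sub>M borel \<Otimes>\<^sub>M borel \<Otimes>\<^sub>M borel)"
    unfolding g_def by measurable
  then have g: "g \<in> borel_measurable borel"
    by (simp add: borel_prod)
  have gX: "g (X \<omega>) = of_bool (quadrant x y \<omega>) * f (X \<omega>)" for \<omega>
    by (simp add: g_def X_def quadrant_def)
  have ig: "integrable M (\<lambda>\<omega>. g (X \<omega>))"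
    unfolding gX by (rule integrable_of_bool_mult) (use i in \<open>auto simp: X_def\<close>)
  have ig': "integrable M (\<lambda>\<omega>. g (X \<omega>) * of_bool (P (pick \<omega>)))" for P
  proof -
    have "{\<omega> \<in> space M. P (pick \<omega>)} = pick -` {v. P v} \<inter> space M"
      by auto
    then have "{\<omega> \<in> space M. P (pick \<omega>)} \<in> sets M"
      using measurable_sets[OF pick_measurable, of "{v. P v}"] by simp
    then show ?thesis
      using integrable_of_bool_mult[OF ig, of "\<lambda>\<omega>. P (pick \<omega>)"] by (simp add: mult.commute)
  qed
  have "(\<integral>\<omega>. g (X \<omega>) * of_bool (pick \<omega> = UA) \<partial>M)
      = (\<integral>\<omega>. g (X \<omega>) * real_cond_exp M F (\<lambda>\<omega>. of_bool (pick \<omega> = UA)) \<omega> \<partial>M)"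
  proof (rule F.real_cond_exp_intg(2)[symmetric, OF ig'])
    show "(\<lambda>\<omega>. g (X \<omega>)) \<in> borel_measurable F"
      unfolding F_def by (rule measurable_compose[OF borel_measurable_vimage_algebra g])
  qed measurable
  also have "\<dots> = (\<integral>\<omega>. g (X \<omega>) * q \<partial>M)"
  proof (rule integral_cong_AE)
    \<comment> \<open>Inside the quadrant, \<open>sub\<close> puts the student in both admission
      regions, where the conditional probability is \<open>q\<close>; outside it
      \<open>g (X \<omega>)\<close> is zero.\<close>
    show "AE \<omega> in M. g (X \<omega>) * real_cond_exp M F (\<lambda>\<omega>. of_bool (pick \<omega> = UA)) \<omega> = g (X \<omega>) * q"
      using pick_uniform adm_iff[of UA] adm_iff[of UB]
    proof eventually_elim
      case (elim \<omega>)
      show ?case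
      proof (cases "quadrant x y \<omega>")
        case True
        with elim sub[of \<omega>] show ?thesis
          by (simp add: cond_exp_def F_def X_def all_university_iff)
      qed (simp add: gX)
    qed
  qed (use ig in \<open>auto intro!: borel_measurable_times borel_measurable_integrable\<close>)
  finally have UA: "(\<integral>\<omega>. g (X \<omega>) * of_bool (pick \<omega> = UA) \<partial>M) = q * (\<integral>\<omega>. g (X \<omega>) \<partial>M)"
    by simp
  have "(\<integral>\<omega>. g (X \<omega>) * of_bool (pick \<omega> = UB) \<partial>M)
      = (\<integral>\<omega>. g (X \<omega>) - g (X \<omega>) * of_bool (pick \<omega> = UA) \<partial>M)"
    by (rule Bochner_Integration.integral_cong) (auto simp: neq_university_iff)
  also have "\<dots> = (1 - q) * (\<integral>\<omega>. g (X \<omega>) \<partial>M)"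
    by (subst Bochner_Integration.integral_diff[OF ig ig']) (simp add: UA algebra_simps)
  finally have "(\<integral>\<omega>. g (X \<omega>) * of_bool (pick \<omega> = u) \<partial>M) = share u * (\<integral>\<omega>. g (X \<omega>) \<partial>M)"
    using UA by (cases u) (auto simp: share_def)
  then show ?thesis
    by (simp add: gX of_bool_conj ac_simps flip: X_def[THEN fun_cong])
qed

lemma integral_att:
  assumes f: "f \<in> borel_measurable borel" and i: "integrable M (\<lambda>\<omega>. f (t \<omega>, s \<omega>, A\<^sub>1 \<omega>, A\<^sub>2 \<omega>) :: real)"
    and "u \<noteq> v"
  defines "x \<equiv> max (cut1 u) (cut1 v)" and "y \<equiv> max (cut2 u) (cut2 v)"
  shows "(\<integral>\<omega>. of_bool (att u \<omega>) * f (t \<omega>, s \<omega>, A\<^sub>1 \<omega>, A\<^sub>2 \<omega>) \<partial>M)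
    = (\<integral>\<omega>. of_bool (quadrant (cut1 u) (cut2 u) \<omega>) * f (t \<omega>, s \<omega>, A\<^sub>1 \<omega>, A\<^sub>2 \<omega>) \<partial>M)
      - share v * (\<integral>\<omega>. of_bool (quadrant x y \<omega>) * f (t \<omega>, s \<omega>, A\<^sub>1 \<omega>, A\<^sub>2 \<omega>) \<partial>M)"
proof -
  let ?f = "\<lambda>\<omega>. f (t \<omega>, s \<omega>, A\<^sub>1 \<omega>, A\<^sub>2 \<omega>)"
  have [measurable]: "?f \<in> borel_measurable M"
    using i by (rule borel_measurable_integrable)
  have xy: "quadrant x y \<omega> \<longleftrightarrow> quadrant (cut1 u) (cut2 u) \<omega> \<and> quadrant (cut1 v) (cut2 v) \<omega>" for \<omega>
    by (auto simp: x_def y_def quadrant_def)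
  have uv: "w \<noteq> u \<longleftrightarrow> w = v" for w
    using \<open>u \<noteq> v\<close> by (cases u; cases v; cases w) auto
  then have uv': "w = u \<longleftrightarrow> w \<noteq> v" for w
    by blast
  have "(\<integral>\<omega>. of_bool (att u \<omega>) * ?f \<omega> \<partial>M)
    = (\<integral>\<omega>. of_bool (quadrant (cut1 u) (cut2 u) \<omega>) * ?f \<omega>
        - of_bool (quadrant x y \<omega> \<and> pick \<omega> = v) * ?f \<omega> \<partial>M)"
  proof (rule integral_cong_AE)
    show "AE \<omega> in M. of_bool (att u \<omega>) * ?f \<omega> = of_bool (quadrant (cut1 u) (cut2 u) \<omega>) * ?f \<omega>
        - of_bool (quadrant x y \<omega> \<and> pick \<omega> = v) * ?f \<omega>"
      using adm_iff[of u] adm_iff[of v]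
    proof eventually_elim
      case (elim \<omega>)
      have "att u \<omega> \<longleftrightarrow> adm u \<omega> \<and> (adm v \<omega> \<longrightarrow> pick \<omega> \<noteq> v)"
        using \<open>u \<noteq> v\<close> by (cases "pick \<omega> = v") (simp_all only: att attends_def uv uv' simp_thms, auto)
      with elim show ?case
        by (auto simp: xy)
    qed
  qed measurable
  also have "\<dots> = (\<integral>\<omega>. of_bool (quadrant (cut1 u) (cut2 u) \<omega>) * ?f \<omega> \<partial>M)
      - (\<integral>\<omega>. of_bool (quadrant x y \<omega> \<and> pick \<omega> = v) * ?f \<omega> \<partial>M)"
    by (intro Bochner_Integration.integral_diff integrable_of_bool_mult[OF i]) measurable
  also have "(\<integral>\<omega>. of_bool (quadrant x y \<omega> \<and> pick \<omega> = v) * ?f \<omega> \<partial>M)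
      = share v * (\<integral>\<omega>. of_bool (quadrant x y \<omega>) * ?f \<omega> \<partial>M)"
  proof (rule integral_pick[OF f i])
    show "quadrant (cut1 w) (cut2 w) \<omega>" if "quadrant x y \<omega>" for w \<omega>
      using uv[of w] that by (auto simp: xy)
  qed
  finally show ?thesis .
qed

lemma average_att:
  assumes "u \<noteq> v"
  defines "x \<equiv> max (cut1 u) (cut1 v)" and "y \<equiv> max (cut2 u) (cut2 v)"
  shows "prob {\<omega> \<in> space M. att u \<omega>} = prob {\<omega> \<in> space M. quadrant (cut1 u) (cut2 u) \<omega>}
      - share v * prob {\<omega> \<in> space M. quadrant x y \<omega>}"
    and "average_over M (att u) t = ((\<integral>\<omega>. of_bool (quadrant (cut1 u) (cut2 u) \<omega>) * t \<omega> \<partial>M)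
      - share v * (\<integral>\<omega>. of_bool (quadrant x y \<omega>) * t \<omega> \<partial>M)) / prob {\<omega> \<in> space M. att u \<omega>}"
    and "average_over M (att u) s = ((\<integral>\<omega>. of_bool (quadrant (cut1 u) (cut2 u) \<omega>) * s \<omega> \<partial>M)
      - share v * (\<integral>\<omega>. of_bool (quadrant x y \<omega>) * s \<omega> \<partial>M)) / prob {\<omega> \<in> space M. att u \<omega>}"
proof -
  have avg: "average_over M (att u) f = (\<integral>\<omega>. of_bool (att u \<omega>) * f \<omega> \<partial>M) / prob {\<omega> \<in> space M. att u \<omega>}" for f
  proof -
    have "(LINT \<omega>:{\<omega> \<in> space M. att u \<omega>}|M. f \<omega>) = (\<integral>\<omega>. of_bool (att u \<omega>) * f \<omega> \<partial>M)"
      unfolding set_lebesgue_integral_def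
      by (rule Bochner_Integration.integral_cong) (auto split: split_indicator)
    then show ?thesis by (simp add: average_over_def)
  qed
  have fst: "fst \<in> borel_measurable (borel :: (real \<times> real \<times> real \<times> real) measure)"
    using measurable_fst[of "borel :: real measure" "borel :: (real \<times> real \<times> real) measure"]
    by (simp only: borel_prod)
  have snd: "(\<lambda>p. fst (snd p)) \<in> borel_measurable (borel :: (real \<times> real \<times> real \<times> real) measure)"
    using measurable_compose[OF measurable_snd measurable_fst,
        of "borel :: real measure" "borel :: real measure" "borel :: (real \<times> real) measure"]
    by (simp only: borel_prod)
  have "(\<integral>\<omega>. of_bool (att u \<omega>) * 1 \<partial>M) = (\<integral>\<omega>. of_bool (quadrant (cut1 u) (cut2 u) \<omega>) * 1 \<partial>M)
      - share v * (\<integral>\<omega>. of_bool (quadrant x y \<omega>) * (1 :: real) \<partial>M)"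
    unfolding x_def y_def by (rule integral_att[OF _ _ assms(1)]) simp_all
  then show "prob {\<omega> \<in> space M. att u \<omega>} = prob {\<omega> \<in> space M. quadrant (cut1 u) (cut2 u) \<omega>}
      - share v * prob {\<omega> \<in> space M. quadrant x y \<omega>}"
    by (simp add: integral_of_bool_eq_prob)
  have "(\<integral>\<omega>. of_bool (att u \<omega>) * t \<omega> \<partial>M) = (\<integral>\<omega>. of_bool (quadrant (cut1 u) (cut2 u) \<omega>) * t \<omega> \<partial>M)
      - share v * (\<integral>\<omega>. of_bool (quadrant x y \<omega>) * t \<omega> \<partial>M)"
    using integral_att[OF fst _ assms(1)] integrable_traits(1) unfolding x_def y_def fst_conv by blast
  then show "average_over M (att u) t = ((\<integral>\<omega>. of_bool (quadrant (cut1 u) (cut2 u) \<omega>) * t \<omega> \<partial>M)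
      - share v * (\<integral>\<omega>. of_bool (quadrant x y \<omega>) * t \<omega> \<partial>M)) / prob {\<omega> \<in> space M. att u \<omega>}"
    by (simp only: avg)
  have "(\<integral>\<omega>. of_bool (att u \<omega>) * s \<omega> \<partial>M) = (\<integral>\<omega>. of_bool (quadrant (cut1 u) (cut2 u) \<omega>) * s \<omega> \<partial>M)
      - share v * (\<integral>\<omega>. of_bool (quadrant x y \<omega>) * s \<omega> \<partial>M)"
    using integral_att[OF snd _ assms(1)] integrable_traits(2) unfolding x_def y_def fst_conv snd_conv by blast
  then show "average_over M (att u) s = ((\<integral>\<omega>. of_bool (quadrant (cut1 u) (cut2 u) \<omega>) * s \<omega> \<partial>M)
      - share v * (\<integral>\<omega>. of_bool (quadrant x y \<omega>) * s \<omega> \<partial>M)) / prob {\<omega> \<in> space M. att u \<omega>}"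
    by (simp only: avg)
qed

lemma average_type_le:
  assumes "cut1 v \<le> cut1 u"
  shows "average_over M (att v) t \<le> average_over M (att u) t"
    and "cut1 v < cut1 u \<Longrightarrow> average_over M (att v) t < average_over M (att u) t"
proof -
  have *: "average_over M (att v) t \<le> average_over M (att u) t"
    "cut1 v < cut1 u \<Longrightarrow> average_over M (att v) t < average_over M (att u) t" if "u \<noteq> v"
  proof -
    note u = average_att[OF that] and v = average_att[OF that[symmetric]]
    \<comment> \<open>Both universities lose students from the same intersection, whose first cutoff
      is that of \<open>u\<close>; the second maxima are only brought to a common form.\<close>
    have max: "max (cut1 u) (cut1 v) = cut1 u" "max (cut1 v) (cut1 u) = cut1 u"
      "max (cut2 v) (cut2 u) = max (cut2 u) (cut2 v)"
      using assms by auto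
    \<comment> \<open>\<open>att_pos\<close>, rewritten by the formula for attendance, provides the
      positive denominators.\<close>
    note le = weighted_type_le[OF assms att_pos[of u, unfolded u(1) max] att_pos[of v, unfolded v(1) max]]
    show "average_over M (att v) t \<le> average_over M (att u) t"
      using le(1) unfolding u(1,2) v(1,2) max .
    show "average_over M (att v) t < average_over M (att u) t" if "cut1 v < cut1 u"
      using le(2)[OF that] unfolding u(1,2) v(1,2) max .
  qed
  show "average_over M (att v) t \<le> average_over M (att u) t"
    using *(1) by (cases "u = v") auto
  show "average_over M (att v) t < average_over M (att u) t" if "cut1 v < cut1 u"
    using *(2) that by (cases "u = v") auto
qed

text \<open>The comparison of weighted means is reused with the metrics exchanged, where each
  quadrant appears with its cutoffs flipped.\<close>

lemma average_skill_le:
  assumes "cut2 v \<le> cut2 u"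
  shows "average_over M (att v) s \<le> average_over M (att u) s"
    and "cut2 v < cut2 u \<Longrightarrow> average_over M (att v) s < average_over M (att u) s"
proof -
  interpret swap: two_metrics M s t Z\<^sub>2 Z\<^sub>1 A\<^sub>2 A\<^sub>1 \<sigma>\<^sub>2 \<sigma>\<^sub>1
    by (rule two_metrics_swap)
  have quadrant: "quadrant x y = swap.quadrant y x" for x y
    by (auto simp: fun_eq_iff quadrant_def swap.quadrant_def)
  have *: "average_over M (att v) s \<le> average_over M (att u) s"
    "cut2 v < cut2 u \<Longrightarrow> average_over M (att v) s < average_over M (att u) s" if "u \<noteq> v"
  proof -
    note u = average_att[OF that] and v = average_att[OF that[symmetric]]
    have max: "max (cut2 u) (cut2 v) = cut2 u" "max (cut2 v) (cut2 u) = cut2 u"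
      "max (cut1 v) (cut1 u) = max (cut1 u) (cut1 v)"
      using assms by auto
    note le = swap.weighted_type_le[OF assms att_pos[of u, unfolded u(1) max quadrant]
        att_pos[of v, unfolded v(1) max quadrant]]
    show "average_over M (att v) s \<le> average_over M (att u) s"
      using le(1) unfolding u(1,3) v(1,3) max quadrant .
    show "average_over M (att v) s < average_over M (att u) s" if "cut2 v < cut2 u"
      using le(2)[OF that] unfolding u(1,3) v(1,3) max quadrant .
  qed
  show "average_over M (att v) s \<le> average_over M (att u) s"
    using *(1) by (cases "u = v") auto
  show "average_over M (att v) s < average_over M (att u) s" if "cut2 v < cut2 u"
    using *(2) that by (cases "u = v") auto
qed

end

section \<open>Order of the cutoffs, order of the preference parameters, and the two cases\<close>

text \<open>Up to positive noise factors the cutoffs are \<open>\<tau> / \<beta>\<close> and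
  \<open>\<tau> / (1 - \<beta>)\<close>. For \<open>\<tau> > 0\<close>, assuming
  \<open>\<beta> \<ge> \<beta>'\<close> makes the first inequality give
  \<open>\<tau>' < \<tau>\<close> and the second \<open>\<tau> < \<tau>'\<close>.\<close>

lemma beta_less_of_crossing_cutoffs:
  fixes \<beta> \<beta>' \<tau> \<tau>' \<sigma>\<^sub>1 \<sigma>\<^sub>2 :: real
  assumes "0 < \<beta>" "\<beta> < 1" "0 < \<beta>'" "\<beta>' < 1" "\<not> (\<tau> < 0 \<and> \<tau>' < 0)"
    and c1: "cutoff1 \<sigma>\<^sub>1 \<beta>' \<tau>' < cutoff1 \<sigma>\<^sub>1 \<beta> \<tau>" and c2: "cutoff2 \<sigma>\<^sub>2 \<beta> \<tau> < cutoff2 \<sigma>\<^sub>2 \<beta>' \<tau>'"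
  shows "\<beta> < \<beta>'"
proof -
  have v: "1 + \<sigma>\<^sup>2 > 0" for \<sigma> :: real
    by (simp add: add_pos_nonneg)
  have "\<tau>' / \<beta>' * (1 + \<sigma>\<^sub>1\<^sup>2) < \<tau> / \<beta> * (1 + \<sigma>\<^sub>1\<^sup>2)"
    "\<tau> / (1 - \<beta>) * (1 + \<sigma>\<^sub>2\<^sup>2) < \<tau>' / (1 - \<beta>') * (1 + \<sigma>\<^sub>2\<^sup>2)"
    using c1 c2 by (simp_all add: cutoff1_def cutoff2_def)
  then have "\<tau>' / \<beta>' < \<tau> / \<beta>" "\<tau> / (1 - \<beta>) < \<tau>' / (1 - \<beta>')"
    using v by (simp_all only: mult_less_cancel_right_pos)
  then have less: "\<tau>' * \<beta> < \<tau> * \<beta>'" "\<tau> * (1 - \<beta>') < \<tau>' * (1 - \<beta>)"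
    using assms by (simp_all add: field_simps)
  \<comment> \<open>If \<open>\<tau> \<le> 0\<close>, the first inequality forces
    \<open>\<tau>' < 0\<close>; the sign hypothesis leaves \<open>\<tau> = 0\<close>, and then the
    second would make \<open>\<tau>' * (1 - \<beta>)\<close> positive.\<close>
  have "\<tau> > 0"
  proof (rule ccontr)
    assume n: "\<not> \<tau> > 0"
    then have "\<tau> * \<beta>' \<le> 0"
      using assms by (simp add: mult_le_0_iff)
    then have "\<tau>' * \<beta> < 0" using less by linarith
    then have "\<tau>' < 0" using assms by (simp add: mult_less_0_iff)
    with assms(5) n have "\<tau> = 0" by simp
    with less(2) \<open>\<tau>' < 0\<close> assms show False by (simp add: zero_less_mult_iff)
  qed
  show ?thesis
  proof (rule ccontr)
    assume "\<not> \<beta> < \<beta>'"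
    then have "\<tau> * \<beta>' \<le> \<tau> * \<beta>" "\<tau> * (1 - \<beta>) \<le> \<tau> * (1 - \<beta>')"
      using \<open>\<tau> > 0\<close> by simp_all
    with less have "\<tau>' * \<beta> < \<tau> * \<beta>" "\<tau> * (1 - \<beta>) < \<tau>' * (1 - \<beta>)"
      by linarith+
    then show False
      using assms by simp
  qed
qed

theorem proposition12:
  fixes M :: "'w measure"
    and t s Z\<^sub>1 Z\<^sub>2 A\<^sub>1 A\<^sub>2 :: "'w \<Rightarrow> real"
    and \<sigma>\<^sub>1 \<sigma>\<^sub>2 q :: real
    and \<beta> \<tau> c\<^sub>1 c\<^sub>2 avg_type avg_skill :: "university \<Rightarrow> real"
    and adm att :: "university \<Rightarrow> 'w \<Rightarrow> bool"
    and pick :: "'w \<Rightarrow> university"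
  assumes "prob_space M"
    and "\<And>X. X \<in> {t, s, Z\<^sub>1, Z\<^sub>2} \<Longrightarrow> distributed M lborel X std_normal_density"
    and "prob_space.indep_vars M (\<lambda>_. borel) (\<lambda>i. [t, s, Z\<^sub>1, Z\<^sub>2] ! i) {0..<4}"
    and "\<sigma>\<^sub>1 \<ge> 0" and "\<sigma>\<^sub>2 \<ge> 0"
    and A1: "A\<^sub>1 = (\<lambda>\<omega>. t \<omega> + \<sigma>\<^sub>1 * Z\<^sub>1 \<omega>)"
    and A2: "A\<^sub>2 = (\<lambda>\<omega>. s \<omega> + \<sigma>\<^sub>2 * Z\<^sub>2 \<omega>)"
    and "\<And>u. 0 < \<beta> u \<and> \<beta> u < 1"
    and "\<beta> UA \<noteq> \<beta> UB"
    \<comment> \<open>without this condition the claim is false, e.g. for \<open>\<beta> UA = 1/4\<close>, \<open>\<beta> UB = 3/4\<close>, \<open>\<tau> UA = \<tau> UB = -1\<close>\<close>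
    and "\<not> (\<tau> UA < 0 \<and> \<tau> UB < 0)"
    and adm: "adm = (\<lambda>u. admits M (\<beta> u) (\<tau> u) t s A\<^sub>1 A\<^sub>2)"
    and pick_measurable: "pick \<in> measurable M (count_space UNIV)"
    and "0 \<le> q" and "q \<le> 1"
    and pick_uniform: "AE \<omega> in M. (\<forall>u. adm u \<omega>) \<longrightarrow>
          cond_exp M (\<lambda>\<omega>. (t \<omega>, s \<omega>, A\<^sub>1 \<omega>, A\<^sub>2 \<omega>)) (\<lambda>\<omega>. of_bool (pick \<omega> = UA)) \<omega> = q"
    and att: "att = attends adm pick"
    \<comment> \<open>the averages are defined; automatic unless \<open>q \<in> {0, 1}\<close>\<close>
    and "\<And>u. measure M {\<omega> \<in> space M. att u \<omega>} > 0"
    and c1: "c\<^sub>1 = (\<lambda>u. cutoff1 \<sigma>\<^sub>1 (\<beta> u) (\<tau> u))"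
    and c2: "c\<^sub>2 = (\<lambda>u. cutoff2 \<sigma>\<^sub>2 (\<beta> u) (\<tau> u))"
    and avg_type: "avg_type = (\<lambda>u. average_over M (att u) t)"
    and avg_skill: "avg_skill = (\<lambda>u. average_over M (att u) s)"
  shows
    \<comment> \<open>strict comparisons whenever the two universities' cutoffs differ in each metric;
        weak ones in (a) if some cutoffs tie\<close>
    "(c\<^sub>1 UA \<noteq> c\<^sub>1 UB \<and> c\<^sub>2 UA \<noteq> c\<^sub>2 UB \<longrightarrow>
        (\<exists>u v. u \<noteq> v \<and> c\<^sub>1 u > c\<^sub>1 v \<and> c\<^sub>2 u > c\<^sub>2 v
               \<and> avg_type u > avg_type v \<and> avg_skill u > avg_skill v) \<or>
        (\<exists>u v. \<beta> u < \<beta> v \<and> avg_type u > avg_type v \<and> avg_skill u < avg_skill v)) \<and>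
     ((\<exists>u v. u \<noteq> v \<and> c\<^sub>1 u \<ge> c\<^sub>1 v \<and> c\<^sub>2 u \<ge> c\<^sub>2 v
               \<and> avg_type u \<ge> avg_type v \<and> avg_skill u \<ge> avg_skill v
               \<and> (c\<^sub>1 u > c\<^sub>1 v \<longrightarrow> avg_type u > avg_type v)
               \<and> (c\<^sub>2 u > c\<^sub>2 v \<longrightarrow> avg_skill u > avg_skill v)) \<or>
      (\<exists>u v. \<beta> u < \<beta> v \<and> avg_type u > avg_type v \<and> avg_skill u < avg_skill v))"
proof -
  interpret M: prob_space M by fact
  \<comment> \<open>Functions of disjoint blocks of the four variables are independent; the indices
    0 to 3 stand for \<open>t\<close>, \<open>s\<close>, \<open>Z\<^sub>1\<close>,
    \<open>Z\<^sub>2\<close>.\<close>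
  have indep: "M.indep_var N (\<lambda>\<omega>. f (restrict (\<lambda>i. ([t, s, Z\<^sub>1, Z\<^sub>2] ! i) \<omega>) I)) N (\<lambda>\<omega>. g (restrict (\<lambda>i. ([t, s, Z\<^sub>1, Z\<^sub>2] ! i) \<omega>) J))"
    if "I \<inter> J = {}" "I \<subseteq> {0..<4}" "J \<subseteq> {0..<4}"
      "f \<in> measurable (Pi\<^sub>M I (\<lambda>_. borel)) N" "g \<in> measurable (Pi\<^sub>M J (\<lambda>_. borel)) N"
    for I J f g and N :: "'n measure"
    using M.indep_var_compose[OF M.indep_var_restrict[OF assms(3) that(1-3)] that(4,5)]
    by (simp add: comp_def)
  interpret two_universities M t s Z\<^sub>1 Z\<^sub>2 A\<^sub>1 A\<^sub>2 \<sigma>\<^sub>1 \<sigma>\<^sub>2 q \<beta> \<tau> adm att pick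
  proof
    show "M.indep_var borel Z\<^sub>1 borel t"
      using indep[of "{2}" "{0}" "\<lambda>x. x 2" borel "\<lambda>x. x 0"] by simp
    show "M.indep_var borel Z\<^sub>2 borel s"
      using indep[of "{3}" "{1}" "\<lambda>x. x 3" borel "\<lambda>x. x 1"] by (simp add: numeral_3_eq_3)
    show "M.indep_var (borel \<Otimes>\<^sub>M borel) (\<lambda>\<omega>. (t \<omega>, Z\<^sub>1 \<omega>)) (borel \<Otimes>\<^sub>M borel) (\<lambda>\<omega>. (s \<omega>, Z\<^sub>2 \<omega>))"
      using indep[of "{0, 2}" "{1, 3}" "\<lambda>x. (x 0, x 2)" "borel \<Otimes>\<^sub>M borel" "\<lambda>x. (x 1, x 3)"]
      by (simp add: numeral_3_eq_3)
  qed (use assms in auto)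
  have cuts: "c\<^sub>1 = cut1" "c\<^sub>2 = cut2"
    by (auto simp: c1 c2 cut1_def cut2_def)
  note type = average_type_le[folded cuts avg_type[THEN fun_cong]]
    and skill = average_skill_le[folded cuts avg_skill[THEN fun_cong]]
  have same: "avg_type v \<le> avg_type u" "avg_skill v \<le> avg_skill u"
    "c\<^sub>1 v < c\<^sub>1 u \<Longrightarrow> avg_type v < avg_type u" "c\<^sub>2 v < c\<^sub>2 u \<Longrightarrow> avg_skill v < avg_skill u"
    if "c\<^sub>1 v \<le> c\<^sub>1 u" "c\<^sub>2 v \<le> c\<^sub>2 u" for u v
    using that type skill by auto
  have crossing: "\<beta> u < \<beta> v \<and> avg_type u > avg_type v \<and> avg_skill u < avg_skill v"
    if "c\<^sub>1 v < c\<^sub>1 u" "c\<^sub>2 u < c\<^sub>2 v" for u v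
  proof -
    have "u \<noteq> v" using that by auto
    then have "\<not> (\<tau> u < 0 \<and> \<tau> v < 0)"
      using assms(10) by (cases u; cases v) auto
    then have "\<beta> u < \<beta> v"
      using beta_less_of_crossing_cutoffs[of "\<beta> u" "\<beta> v" "\<tau> u" "\<tau> v" \<sigma>\<^sub>1 \<sigma>\<^sub>2] beta that
      by (simp add: c1 c2)
    then show ?thesis
      using type(2)[of v u] skill(2)[of u v] that by simp
  qed
  \<comment> \<open>The two metrics order the universities either in the same way, ties allowed, or
    in strictly opposite ways.\<close>
  consider u v where "u \<noteq> v" "c\<^sub>1 v \<le> c\<^sub>1 u" "c\<^sub>2 v \<le> c\<^sub>2 u"
    | u v where "c\<^sub>1 v < c\<^sub>1 u" "c\<^sub>2 u < c\<^sub>2 v"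
    using that[of UA UB] that[of UB UA] by (metis linorder_le_cases linorder_not_le university.distinct(1))
  then show ?thesis
  proof cases
    case (1 u v)
    \<comment> \<open>Distinct cutoffs make the weak inequalities of this case strict, which yields
      the strict form of (a).\<close>
    have "c\<^sub>1 UA \<noteq> c\<^sub>1 UB \<and> c\<^sub>2 UA \<noteq> c\<^sub>2 UB \<Longrightarrow> c\<^sub>1 v < c\<^sub>1 u \<and> c\<^sub>2 v < c\<^sub>2 u"
      using 1 by (cases u; cases v) auto
    with 1 same[OF 1(2,3)] show ?thesis by blast
  next
    case (2 u v)
    from crossing[OF this] show ?thesis by blast
  qed
qed

end
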